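(* Let $\mathcal{A}_{d} \subset \mathbb{P}^{2}$ be a star arrangement of $d \geq 3$ lines in the complex projective plane. Then $$\varepsilon(\mathbb{P}^{2}, \mathcal{O}_{\mathbb{P}^{2}}(1); \mathrm{Sing}(\mathcal{A}_{d})) = \frac{1}{d-1}.$$
   Context: We work over the complex numbers. A line arrangement is a finite set of distinct lines in $\mathbb{P}^2$; its singular locus $\mathrm{Sing}$ is the set of points lying on at least two lines of the arrangement. A star arrangement of $d$ lines is an arrangement $\mathcal{A}_d$ of $d$ lines all of whose intersection points are double points (i.e. lie on exactly two lines of the arrangement). For a finite set of points $\mathcal{P}=\{p_1,\dots,p_r\}\subset\mathbb{P}^2$, the multi-point Seshadri constant is $$\varepsilon(\mathbb{P}^{2}, \mathcal{O}_{\mathbb{P}^{2}}(1); \mathcal{P}) = \inf_{C \cap \mathcal{P} \neq \emptyset} \frac{\deg C}{\sum_{i=1}^{r} \mathrm{mult}_{p_{i}} C},$$ where the infimum is over all irreducible and reduced curves $C \subset \mathbb{P}^2$ passing through at least one point of $\mathcal{P}$. *)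

theory Defs
  imports "HOL-Analysis.Analysis" "HOL-Library.Poly_Mapping"
    "HOL-Computational_Algebra.Factorial_Ring"
begin

definition same_point :: "complex^3 \<Rightarrow> complex^3 \<Rightarrow> bool" where
  "same_point v w \<longleftrightarrow> v \<noteq> 0 \<and> w \<noteq> 0 \<and> (\<exists>c. c \<noteq> 0 \<and> w = c *s v)"

lemma part_equivp_same_point: "part_equivp same_point"
proof (rule part_equivpI)
  have "same_point (1::complex^3) 1"
    unfolding same_point_def by (intro conjI exI[of _ 1]) auto
  then show "\<exists>v. same_point v v" by blast
  show "symp same_point"
  proof (rule sympI)
    fix v w assume "same_point v w"
    then obtain c where "v \<noteq> 0" "w \<noteq> 0" "c \<noteq> 0" "w = c *s v"
      unfolding same_point_def by blast
    then show "same_point w v"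
      unfolding same_point_def
      by (intro conjI exI[of _ "inverse c"]) (auto simp: vector_smult_assoc)
  qed
  show "transp same_point"
  proof (rule transpI)
    fix u v w assume "same_point u v" "same_point v w"
    then obtain b c where "u \<noteq> 0" "w \<noteq> 0" "b \<noteq> 0" "c \<noteq> 0" "v = b *s u" "w = c *s v"
      unfolding same_point_def by blast
    then show "same_point u w"
      unfolding same_point_def
      by (intro conjI exI[of _ "c * b"]) (auto simp: vector_smult_assoc)
  qed
qed

quotient_type proj_plane = "complex^3" / partial: same_point
  morphisms rep_point point
  by (rule part_equivp_same_point)

text \<open>A monomial is its exponent vector; the multiplication of \<open>\<Rightarrow>\<^sub>0\<close> is the
  convolution product, so this type is the polynomial ring over the complex numbers in
  three variables.\<close>

type_synonym monom3 = "3 \<Rightarrow>\<^sub>0 nat"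
type_synonym poly3 = "monom3 \<Rightarrow>\<^sub>0 complex"

definition const3 :: "complex \<Rightarrow> poly3" where
  "const3 c = Poly_Mapping.single 0 c"

definition var3 :: "3 \<Rightarrow> poly3" where
  "var3 i = Poly_Mapping.single (Poly_Mapping.single i 1) 1"

definition monom_deg :: "monom3 \<Rightarrow> nat" where
  "monom_deg m = (\<Sum>i\<in>UNIV. Poly_Mapping.lookup m i)"

definition eval3 :: "poly3 \<Rightarrow> complex^3 \<Rightarrow> complex" where
  "eval3 F v = (\<Sum>m\<in>Poly_Mapping.keys F. Poly_Mapping.lookup F m * (\<Prod>i\<in>UNIV. (v $ i) ^ Poly_Mapping.lookup m i))"

definition subst3 :: "poly3 \<Rightarrow> (3 \<Rightarrow> poly3) \<Rightarrow> poly3" where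
  "subst3 F g = (\<Sum>m\<in>Poly_Mapping.keys F. const3 (Poly_Mapping.lookup F m) * (\<Prod>i\<in>UNIV. g i ^ Poly_Mapping.lookup m i))"

text \<open>\<open>total_deg\<close> and \<open>low_deg\<close> are meaningful only for nonzero polynomials.\<close>

definition total_deg :: "poly3 \<Rightarrow> nat" where
  "total_deg F = Max (monom_deg ` Poly_Mapping.keys F)"

definition low_deg :: "poly3 \<Rightarrow> nat" where
  "low_deg f = Min (monom_deg ` Poly_Mapping.keys f)"

definition homogeneous3 :: "poly3 \<Rightarrow> bool" where
  "homogeneous3 F \<longleftrightarrow> (\<exists>n. \<forall>m\<in>Poly_Mapping.keys F. monom_deg m = n)"

text \<open>Irreducible and reduced plane curves are given by irreducible forms, uniquely up to a
  nonzero scalar factor; degree, points and multiplicities do not depend on that factor.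
  Forms of degree \<open>0\<close> are excluded, since \<open>irreducible\<close> excludes zero and units.\<close>

definition integral_curve :: "poly3 \<Rightarrow> bool" where
  "integral_curve F \<longleftrightarrow> homogeneous3 F \<and> irreducible F"

definition curve_points :: "poly3 \<Rightarrow> proj_plane set" where
  "curve_points F = {point v | v. v \<noteq> 0 \<and> eval3 F v = 0}"

text \<open>The equation of the curve \<open>F = 0\<close> near a point: in the affine chart \<open>x\<^sub>i = 1\<close>, for an \<open>i\<close>
  such that the \<open>i\<close>-th coordinate of the point is nonzero, translated so that the point becomes
  the origin. The affine coordinates are the two variables other than \<open>x\<^sub>i\<close>.
  The order of vanishing at the origin does not depend on the chart chosen.\<close>

lift_definition local_equation :: "poly3 \<Rightarrow> proj_plane \<Rightarrow> poly3" is
  "\<lambda>F v. let i = (SOME i. v $ i \<noteq> 0)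
          in subst3 F (\<lambda>j. if j = i then 1 else var3 j + const3 (v $ j / v $ i))"
proof -
  fix F :: poly3 and v w :: "complex^3"
  assume "same_point v w"
  then obtain c where c: "c \<noteq> 0" and w: "w = c *s v"
    unfolding same_point_def by blast
  have "(\<lambda>i. w $ i \<noteq> 0) = (\<lambda>i. v $ i \<noteq> 0)"
    using c w by (auto simp: fun_eq_iff)
  moreover have "w $ j / w $ i = v $ j / v $ i" for i j
    using c w by simp
  ultimately show "(let i = (SOME i. v $ i \<noteq> 0)
          in subst3 F (\<lambda>j. if j = i then 1 else var3 j + const3 (v $ j / v $ i))) =
      (let i = (SOME i. w $ i \<noteq> 0)
          in subst3 F (\<lambda>j. if j = i then 1 else var3 j + const3 (w $ j / w $ i)))"
    by presburger
qed

definition curve_mult :: "proj_plane \<Rightarrow> poly3 \<Rightarrow> nat" where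
  "curve_mult p F = low_deg (local_equation F p)"

text \<open>Meant for finite nonempty \<open>P\<close>. Then the set of quotients is nonempty and bounded below by
  \<open>0\<close>, so the real infimum is the true one; the denominators are positive because the curve
  meets \<open>P\<close>.\<close>

definition seshadri_O1 :: "proj_plane set \<Rightarrow> real" where
  "seshadri_O1 P =
    (INF F\<in>{F. integral_curve F \<and> curve_points F \<inter> P \<noteq> {}}.
      real (total_deg F) / (\<Sum>p\<in>P. real (curve_mult p F)))"

definition is_line :: "proj_plane set \<Rightarrow> bool" where
  "is_line L \<longleftrightarrow> (\<exists>a::complex^3. a \<noteq> 0 \<and> L = {point v | v. v \<noteq> 0 \<and> (\<Sum>i\<in>UNIV. a $ i * v $ i) = 0})"

definition line_arrangement :: "proj_plane set set \<Rightarrow> bool" where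
  "line_arrangement A \<longleftrightarrow> finite A \<and> (\<forall>L\<in>A. is_line L)"

definition Sing :: "proj_plane set set \<Rightarrow> proj_plane set" where
  "Sing A = {p. card {L \<in> A. p \<in> L} \<ge> 2}"

definition star_arrangement :: "proj_plane set set \<Rightarrow> bool" where
  "star_arrangement A \<longleftrightarrow> line_arrangement A \<and> (\<forall>p\<in>Sing A. card {L \<in> A. p \<in> L} = 2)"

end

theory Submission
  imports Defs "HOL-Computational_Algebra.Polynomial"
begin

text \<open>Let \<open>C\<close> be an irreducible curve of degree \<open>n\<close>, and let \<open>m\<close> be the sum of its multiplicities at
  the singular points of the arrangement. The claim amounts to \<open>m \<le> (d - 1) n\<close>, with equality
  for some curve.

  If \<open>C\<close> is one of the lines \<open>L\<close> of the arrangement, then \<open>n = 1\<close>, and \<open>m\<close> is the number of singular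
  points on \<open>L\<close>. Each of the other \<open>d - 1\<close> lines meets \<open>L\<close> in one point, and no two of them in the
  same point since all intersection points are double; hence \<open>m = d - 1\<close> and the bound is attained
  (\<open>card_Sing_on_line\<close>, \<open>sum_curve_mult_arrangement_line\<close>).

  If \<open>C\<close> is not a line of the arrangement, then it contains none of these lines, because a form
  that vanishes on a line is divisible by its linear form (\<open>linear_form_dvd\<close>), and an irreducible
  form is then a multiple of it. By Bezout's theorem
  the multiplicities of \<open>C\<close> at the points of a line of the arrangement add up to at most \<open>n\<close>. Every
  singular point lies on exactly two of the lines, so summing over all lines yields \<open>2 m \<le> d n\<close>, and
  \<open>d \<le> 2 (d - 1)\<close>.

  The only case of Bezout's theorem that enters is the intersection with a line, and it is
  elementary: restricting the form to a parametrized line gives a polynomial in one variable of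
  degree at most \<open>n\<close>, and a point of multiplicity \<open>k\<close> is a root of order at least \<open>k\<close>
  (\<open>curve_mult_dvd_line_poly\<close>, \<open>sum_curve_mult_on_line_le\<close>). Statements on
  polynomials in three variables are reduced to statements on their values, since the values
  determine the polynomial (\<open>poly3_eqI\<close>).\<close>

section \<open>Evaluation of ternary polynomials\<close>

abbreviation eval_monom :: "complex^3 \<Rightarrow> monom3 \<Rightarrow> complex" where
  "eval_monom v m \<equiv> (\<Prod>i\<in>UNIV. (v $ i) ^ Poly_Mapping.lookup m i)"

text \<open>Polynomials with different supports are compared termwise by summing over a common
  finite superset of the supports.\<close>

lemma eval3_superset:
  assumes "finite S" "Poly_Mapping.keys F \<subseteq> S"
  shows "eval3 F v = (\<Sum>m\<in>S. Poly_Mapping.lookup F m * eval_monom v m)"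
  unfolding eval3_def using assms
  by (intro sum.mono_neutral_left) (auto simp: in_keys_iff)

lemma eval3_zero [simp]: "eval3 0 v = 0"
  by (simp add: eval3_def)

lemma eval3_single [simp]: "eval3 (Poly_Mapping.single m c) v = c * eval_monom v m"
  by (subst eval3_superset[of "{m}"]) auto

lemma eval3_add [simp]: "eval3 (F + G) v = eval3 F v + eval3 G v"
proof -
  let ?S = "Poly_Mapping.keys F \<union> Poly_Mapping.keys G"
  have "finite ?S" "Poly_Mapping.keys (F + G) \<subseteq> ?S"
    using keys_add[of F G] by auto
  then show ?thesis
    by (simp add: eval3_superset[of ?S] lookup_add algebra_simps sum.distrib)
qed

lemma eval3_diff [simp]: "eval3 (F - G) v = eval3 F v - eval3 G v"
  using eval3_add[of "F - G" G v] by simp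

lemma eval3_sum [simp]: "eval3 (sum f S) v = (\<Sum>x\<in>S. eval3 (f x) v)"
  by (induction S rule: infinite_finite_induct) auto

lemma poly3_expansion:
  fixes F :: poly3
  shows "F = (\<Sum>m\<in>Poly_Mapping.keys F. Poly_Mapping.single m (Poly_Mapping.lookup F m))"
  by (rule poly_mapping_eqI)
    (auto simp: lookup_sum lookup_single when_def sum.delta' in_keys_iff)

lemma eval_monom_add: "eval_monom v (m + n) = eval_monom v m * eval_monom v n"
  by (simp add: lookup_add power_add prod.distrib)

lemma eval3_mult [simp]: "eval3 (F * G) v = eval3 F v * eval3 G v"
proof -
  let ?m = "\<lambda>F m. Poly_Mapping.single m (Poly_Mapping.lookup F m)"
  have "F * G = (\<Sum>m\<in>Poly_Mapping.keys F. \<Sum>n\<in>Poly_Mapping.keys G. ?m F m * ?m G n)"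
    unfolding sum_product[symmetric] poly3_expansion[symmetric] ..
  then have "eval3 (F * G) v = (\<Sum>m\<in>Poly_Mapping.keys F. \<Sum>n\<in>Poly_Mapping.keys G.
      Poly_Mapping.lookup F m * eval_monom v m * (Poly_Mapping.lookup G n * eval_monom v n))"
    by (simp add: mult_single eval_monom_add algebra_simps del: prod.distrib)
  then show ?thesis
    by (simp add: eval3_def sum_product)
qed

lemma eval3_const3 [simp]: "eval3 (const3 c) v = c"
  by (simp add: const3_def)

lemma eval3_one [simp]: "eval3 1 v = 1"
  using eval3_const3[of 1 v] by (simp add: const3_def)

lemma eval3_var3 [simp]: "eval3 (var3 j) v = v $ j"
proof -
  have "eval_monom v (Poly_Mapping.single j 1) = (\<Prod>i\<in>UNIV. if i = j then v $ j else 1)"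
    by (intro prod.cong) (auto simp: lookup_single when_def)
  then show ?thesis
    by (simp add: var3_def)
qed

lemma eval3_power [simp]: "eval3 (F ^ n) v = eval3 F v ^ n"
  by (induction n) auto

lemma eval3_prod [simp]: "eval3 (prod f S) v = (\<Prod>x\<in>S. eval3 (f x) v)"
  by (induction S rule: infinite_finite_induct) auto

lemma eval3_subst3: "eval3 (subst3 F g) v = eval3 F (\<chi> i. eval3 (g i) v)"
  by (simp add: subst3_def eval3_def[of F])

text \<open>The complex numbers are infinite, so a polynomial is determined by its values. The proof
  uses Kronecker substitution: for \<open>N\<close> larger than all exponents, the substitution
  \<open>(t, t ^ N, t ^ (N * N))\<close> sends distinct monomials to distinct powers of \<open>t\<close>, because the exponents
  become the base-\<open>N\<close> digits of the new exponent.\<close>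

lemma poly3_eqI:
  assumes "\<And>v. eval3 F v = eval3 G v"
  shows "F = G"
proof -
  define H where "H = F - G"
  define N where "N = Suc (\<Sum>m\<in>Poly_Mapping.keys H. monom_deg m)"
  define code where "code m = Poly_Mapping.lookup m 1 + N * (Poly_Mapping.lookup m 2 + N * Poly_Mapping.lookup m 3)"
    for m :: monom3
  have small: "Poly_Mapping.lookup m i < N" if "m \<in> Poly_Mapping.keys H" for m i
  proof -
    have "Poly_Mapping.lookup m i \<le> monom_deg m"
      unfolding monom_deg_def by (rule member_le_sum) auto
    also have "\<dots> \<le> (\<Sum>m\<in>Poly_Mapping.keys H. monom_deg m)"
      using that by (intro member_le_sum) auto
    finally show ?thesis by (simp add: N_def)
  qed
  have inj: "inj_on code (Poly_Mapping.keys H)"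
  proof (rule inj_onI)
    fix m n assume mn: "m \<in> Poly_Mapping.keys H" "n \<in> Poly_Mapping.keys H" "code m = code n"
    have digits: "a = a' \<and> b = b'"
      if "a + N * b = a' + N * b'" "a < N" "a' < N" for a a' b b' :: nat
      using arg_cong[OF that(1), of "\<lambda>x. x mod N"] arg_cong[OF that(1), of "\<lambda>x. x div N"] that(2,3)
      by simp
    have "Poly_Mapping.lookup m 1 = Poly_Mapping.lookup n 1 \<and>
        Poly_Mapping.lookup m 2 + N * Poly_Mapping.lookup m 3 = Poly_Mapping.lookup n 2 + N * Poly_Mapping.lookup n 3"
      using mn small unfolding code_def by (intro digits) auto
    moreover from this have "Poly_Mapping.lookup m 2 = Poly_Mapping.lookup n 2 \<and> Poly_Mapping.lookup m 3 = Poly_Mapping.lookup n 3"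
      using mn small by (intro digits) auto
    ultimately have "\<forall>i. Poly_Mapping.lookup m i = Poly_Mapping.lookup n i"
      unfolding forall_3 by simp
    then show "m = n" by (intro poly_mapping_eqI) auto
  qed
  define P where "P = (\<Sum>m\<in>Poly_Mapping.keys H. monom (Poly_Mapping.lookup H m) (code m))"
  have "poly P t = 0" for t
  proof -
    let ?v = "vector [t, t ^ N, t ^ (N * N)] :: complex^3"
    have "eval_monom ?v m = t ^ code m" for m
      unfolding UNIV_3 code_def by (simp add: vector_3 power_add algebra_simps flip: power_mult)
    then have "poly P t = eval3 H ?v"
      by (simp add: P_def eval3_def poly_sum poly_monom)
    then show ?thesis using assms by (simp add: H_def)
  qed
  then have "P = 0" using poly_all_0_iff_0 by blast
  have "Poly_Mapping.lookup H m = 0" for m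
  proof (rule ccontr)
    assume nz: "Poly_Mapping.lookup H m \<noteq> 0"
    then have m: "m \<in> Poly_Mapping.keys H" by (simp add: in_keys_iff)
    have "coeff P (code m) = (\<Sum>n\<in>Poly_Mapping.keys H. if n = m then Poly_Mapping.lookup H n else 0)"
      unfolding P_def coeff_sum coeff_monom
      using inj m by (intro sum.cong) (auto dest: inj_onD)
    with m nz \<open>P = 0\<close> show False by simp
  qed
  then have "H = 0" by (intro poly_mapping_eqI) auto
  then show ?thesis by (simp add: H_def)
qed

section \<open>Restriction of forms to lines\<close>

definition line_poly :: "poly3 \<Rightarrow> complex^3 \<Rightarrow> complex^3 \<Rightarrow> complex poly" where
  "line_poly F b c = (\<Sum>m\<in>Poly_Mapping.keys F.
     smult (Poly_Mapping.lookup F m) (\<Prod>i\<in>UNIV. [:b $ i, c $ i:] ^ Poly_Mapping.lookup m i))"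

lemma poly_line_poly [simp]: "poly (line_poly F b c) t = eval3 F (b + t *s c)"
  by (simp add: line_poly_def eval3_def poly_sum poly_prod)

lemma degree_line_poly: "degree (line_poly F b c) \<le> total_deg F"
  unfolding line_poly_def
proof (intro degree_sum_le)
  fix m assume m: "m \<in> Poly_Mapping.keys F"
  have "degree (\<Prod>i\<in>UNIV. [:b $ i, c $ i:] ^ Poly_Mapping.lookup m i)
      \<le> (\<Sum>i\<in>UNIV. degree ([:b $ i, c $ i:] ^ Poly_Mapping.lookup m i))"
    using degree_prod_sum_le[of UNIV "\<lambda>i. [:b $ i, c $ i:] ^ Poly_Mapping.lookup m i"]
    by (simp add: comp_def)
  also have "\<dots> \<le> (\<Sum>i\<in>UNIV. Poly_Mapping.lookup m i)"
  proof (rule sum_mono)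
    fix i
    show "degree ([:b $ i, c $ i:] ^ Poly_Mapping.lookup m i) \<le> Poly_Mapping.lookup m i"
      by (rule order_trans[OF degree_power_le]) simp
  qed
  also have "\<dots> \<le> total_deg F"
    unfolding total_deg_def using m by (auto simp: monom_deg_def[symmetric])
  finally show "degree (smult (Poly_Mapping.lookup F m)
      (\<Prod>i\<in>UNIV. [:b $ i, c $ i:] ^ Poly_Mapping.lookup m i)) \<le> total_deg F"
    using degree_smult_le order_trans by blast
qed simp

lemma eval_monom_scale: "eval_monom (t *s v) m = t ^ monom_deg m * eval_monom v m"
  by (simp add: power_mult_distrib prod.distrib power_sum monom_deg_def)

lemma monom_deg_homogeneous:
  assumes "homogeneous3 F" "m \<in> Poly_Mapping.keys F"
  shows "monom_deg m = total_deg F"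
proof -
  obtain n where "\<And>m. m \<in> Poly_Mapping.keys F \<Longrightarrow> monom_deg m = n"
    using assms(1) by (auto simp: homogeneous3_def)
  then have "monom_deg ` Poly_Mapping.keys F = {n}" "monom_deg m = n"
    using assms(2) by auto
  then show ?thesis by (simp add: total_deg_def)
qed

lemma eval3_scale:
  assumes "homogeneous3 F"
  shows "eval3 F (t *s v) = t ^ total_deg F * eval3 F v"
  unfolding eval3_def sum_distrib_left
  by (intro sum.cong) (auto simp: eval_monom_scale monom_deg_homogeneous[OF assms] simp del: vector_smult_component)

section \<open>Multiplicities and restrictions to lines\<close>

lemma same_point_refl: "same_point v v \<longleftrightarrow> v \<noteq> 0"
  unfolding same_point_def by (auto intro!: exI[of _ 1])

lemma point_exhaust:
  obtains v where "v \<noteq> 0" "p = point v"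
  by (induction p rule: proj_plane.abs_induct) (auto simp: same_point_refl)

lemma point_eq_iff:
  assumes "v \<noteq> 0" "w \<noteq> 0"
  shows "point v = point w \<longleftrightarrow> (\<exists>c. c \<noteq> 0 \<and> w = c *s v)"
  using Quotient3_rel[OF Quotient3_proj_plane, of v w] assms
  by (simp add: same_point_refl) (simp add: same_point_def)

lemma vec_nonzero_component:
  fixes v :: "complex^3"
  assumes "v \<noteq> 0"
  obtains i where "v $ i \<noteq> 0"
  using assms by (auto simp: vec_eq_iff)

text \<open>A form can be recovered from its equation in an affine chart: dividing \<open>x\<close> by its \<open>i\<close>-th
  coordinate moves it to the chart \<open>x\<^sub>i = 1\<close>, and subtracting the normalized vector \<open>v\<close> moves the
  point to the origin of that chart. All later facts on multiplicities use the local equation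
  only through this formula.\<close>

lemma eval3_via_local_equation:
  assumes F: "homogeneous3 F" and v: "v \<noteq> 0"
  obtains i where "v $ i \<noteq> 0"
    "\<And>x. x $ i \<noteq> 0 \<Longrightarrow> eval3 F x = (x $ i) ^ total_deg F *
       eval3 (local_equation F (point v)) (inverse (x $ i) *s x - inverse (v $ i) *s v)"
proof -
  define i where "i = (SOME i. v $ i \<noteq> 0)"
  have vi: "v $ i \<noteq> 0"
    unfolding i_def using vec_nonzero_component[OF v] by (metis (mono_tags, lifting) someI_ex)
  have f: "local_equation F (point v) =
      subst3 F (\<lambda>j. if j = i then 1 else var3 j + const3 (v $ j / v $ i))"
    using local_equation.abs_eq[of v F] v unfolding same_point_refl i_def Let_def by blast
  show ?thesis
  proof (rule that[OF vi])
    fix x :: "complex^3" assume xi: "x $ i \<noteq> 0"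
    have "(\<chi> j. eval3 (if j = i then 1 else var3 j + const3 (v $ j / v $ i))
        (inverse (x $ i) *s x - inverse (v $ i) *s v)) = inverse (x $ i) *s x"
      using xi by (simp add: vec_eq_iff divide_inverse mult.commute)
    moreover have "x = (x $ i) *s (inverse (x $ i) *s x)"
      using xi by (simp add: vector_smult_assoc)
    ultimately show "eval3 F x = (x $ i) ^ total_deg F *
        eval3 (local_equation F (point v)) (inverse (x $ i) *s x - inverse (v $ i) *s v)"
      unfolding f eval3_subst3 using eval3_scale[OF F] by metis
  qed
qed

lemma monom_deg_eq_0_iff: "monom_deg m = 0 \<longleftrightarrow> m = 0"
  unfolding monom_deg_def by (simp add: poly_mapping_eq_iff fun_eq_iff)

lemma eval3_at_0: "eval3 f 0 = Poly_Mapping.lookup f 0"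
proof -
  have "eval_monom 0 m = (if m = 0 then 1 else 0)" for m
  proof (cases "m = 0")
    case False
    then obtain i where "Poly_Mapping.lookup m i \<noteq> 0"
      by (metis poly_mapping_eqI lookup_zero)
    then have "(0 :: complex^3) $ i ^ Poly_Mapping.lookup m i = 0"
      by simp
    then have "eval_monom 0 m = 0"
      by (intro prod_zero) (use finite in blast)+
    then show ?thesis using False by simp
  qed simp
  then have "eval3 f 0 = (\<Sum>m\<in>Poly_Mapping.keys f. if m = 0 then Poly_Mapping.lookup f m else 0)"
    unfolding eval3_def by (intro sum.cong) auto
  then show ?thesis by (simp add: in_keys_iff)
qed

text \<open>If the local equation were zero, then the form would vanish off the line \<open>x\<^sub>i = 0\<close>, hence
  everywhere, as one sees on the line joining the given point to any other one. Without this
  fact, the minimum that defines the multiplicity would be taken over the empty set.\<close>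

lemma local_equation_nonzero:
  assumes F: "homogeneous3 F" "F \<noteq> 0"
  shows "local_equation F p \<noteq> 0"
proof
  assume f: "local_equation F p = 0"
  obtain v where v: "v \<noteq> 0" "p = point v" by (rule point_exhaust)
  obtain i where i: "v $ i \<noteq> 0" "\<And>x. x $ i \<noteq> 0 \<Longrightarrow> eval3 F x = 0"
    using eval3_via_local_equation[OF F(1) v(1)] f v(2) by (metis eval3_zero mult_zero_right)
  obtain c where c: "eval3 F c \<noteq> 0"
    using poly3_eqI[of F 0] F(2) by auto
  \<comment> \<open>The extra factor is the \<open>i\<close>-th coordinate of \<open>c + t v\<close>; it covers the one parameter
      at which that coordinate may vanish.\<close>
  have "poly ([:c $ i, v $ i:] * line_poly F c v) t = 0" for t
    unfolding poly_mult poly_line_poly using i(2)[of "c + t *s v"] by auto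
  then have "[:c $ i, v $ i:] * line_poly F c v = 0"
    using poly_all_0_iff_0 by blast
  then have "line_poly F c v = 0" using i(1) unfolding mult_eq_0_iff by simp
  then have "poly (line_poly F c v) 0 = 0" by simp
  with c show False by simp
qed

lemma curve_mult_eq_0_iff:
  assumes F: "homogeneous3 F" "F \<noteq> 0" and v: "v \<noteq> 0"
  shows "curve_mult (point v) F = 0 \<longleftrightarrow> eval3 F v \<noteq> 0"
proof -
  define f where "f = local_equation F (point v)"
  have ne: "Poly_Mapping.keys f \<noteq> {}"
    using local_equation_nonzero[OF F] by (simp add: f_def)
  obtain i where i: "v $ i \<noteq> 0" "eval3 F v = (v $ i) ^ total_deg F * eval3 f 0"
    using eval3_via_local_equation[OF F(1) v] unfolding f_def by (metis diff_self)
  have "curve_mult (point v) F = 0 \<longleftrightarrow> 0 \<in> monom_deg ` Poly_Mapping.keys f"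
    unfolding curve_mult_def low_deg_def f_def[symmetric]
    using ne by (simp add: Min_eq_iff)
  also have "\<dots> \<longleftrightarrow> Poly_Mapping.lookup f 0 \<noteq> 0"
    unfolding image_iff in_keys_iff[symmetric] using monom_deg_eq_0_iff by metis
  also have "\<dots> \<longleftrightarrow> eval3 F v \<noteq> 0"
    using i by (simp add: eval3_at_0)
  finally show ?thesis .
qed

text \<open>A form of multiplicity \<open>k\<close> at a point vanishes to order at least \<open>k\<close> at that point along every
  line through it. In the affine chart the points of the line are the multiples of one
  direction \<open>u\<close>, and every monomial of the local equation has degree at least \<open>k\<close>.
  Here the affine parameter is the rational function \<open>s / l\<close>, where \<open>s = t - t\<^sub>0\<close> and where the
  denominator \<open>l\<close>, the \<open>i\<close>-th coordinate along the line, does not vanish at \<open>t\<^sub>0\<close>; clearing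
  denominators therefore does not change the order at \<open>t\<^sub>0\<close>.\<close>

lemma curve_mult_dvd_line_poly:
  assumes F: "homogeneous3 F" and v: "b + t\<^sub>0 *s c \<noteq> 0"
  shows "[:- t\<^sub>0, 1:] ^ curve_mult (point (b + t\<^sub>0 *s c)) F dvd line_poly F b c"
proof -
  define v where "v = b + t\<^sub>0 *s c"
  define f where "f = local_equation F (point v)"
  define G where "G = line_poly F b c"
  obtain i where i: "v $ i \<noteq> 0"
    "\<And>x. x $ i \<noteq> 0 \<Longrightarrow> eval3 F x =
       (x $ i) ^ total_deg F * eval3 f (inverse (x $ i) *s x - inverse (v $ i) *s v)"
    using eval3_via_local_equation[OF F] v unfolding v_def f_def by blast
  define u where "u = c - (c $ i / v $ i) *s v"
  define s where "s = [:- t\<^sub>0, 1:]"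
  define l where "l = [:b $ i, c $ i:]"
  define N where "N = (\<Sum>m\<in>Poly_Mapping.keys f. monom_deg m)"
  define R where "R = (\<Sum>m\<in>Poly_Mapping.keys f.
    smult (Poly_Mapping.lookup f m * eval_monom u m) (s ^ monom_deg m * l ^ (N - monom_deg m)))"
  have l0: "poly l t\<^sub>0 \<noteq> 0"
    using i(1) by (simp add: l_def v_def)
  \<comment> \<open>The power \<open>N\<close> clears all denominators. One further factor \<open>l\<close> makes the identity hold
      also where \<open>l\<close> vanishes.\<close>
  have "poly (l ^ Suc N * G) t = poly (l ^ Suc (total_deg F) * R) t" for t
  proof (cases "poly l t = 0")
    case False
    define x where "x = b + t *s c"
    define r where "r = poly s t / poly l t"
    have xi: "x $ i = poly l t" by (simp add: x_def l_def)
    have x: "x = v + poly s t *s c"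
      by (simp add: x_def v_def s_def vec_eq_iff algebra_simps)
    have "inverse (x $ i) *s x - inverse (v $ i) *s v = r *s u"
    proof -
      have "inverse (x $ i) * x $ j - inverse (v $ i) * v $ j = r * u $ j" for j
        using False i(1) unfolding r_def xi[symmetric] u_def
        by (simp add: x field_simps)
      then show ?thesis by (simp add: vec_eq_iff)
    qed
    then have "eval3 F x = poly l t ^ total_deg F *
        (\<Sum>m\<in>Poly_Mapping.keys f. Poly_Mapping.lookup f m * (r ^ monom_deg m * eval_monom u m))"
      using i(2)[of x] False xi
      by (simp add: eval3_def[of f] eval_monom_scale del: vector_smult_component)
    moreover have "poly l t ^ N *
        (\<Sum>m\<in>Poly_Mapping.keys f. Poly_Mapping.lookup f m * (r ^ monom_deg m * eval_monom u m)) = poly R t"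
      unfolding R_def poly_sum sum_distrib_left
    proof (intro sum.cong refl)
      fix m assume "m \<in> Poly_Mapping.keys f"
      then have "monom_deg m \<le> N"
        unfolding N_def by (intro member_le_sum) auto
      then have "poly l t ^ N = poly l t ^ (N - monom_deg m) * poly l t ^ monom_deg m"
        by (simp flip: power_add)
      then show "poly l t ^ N * (Poly_Mapping.lookup f m * (r ^ monom_deg m * eval_monom u m)) =
          poly (smult (Poly_Mapping.lookup f m * eval_monom u m) (s ^ monom_deg m * l ^ (N - monom_deg m))) t"
        using False by (simp add: r_def power_divide)
    qed
    ultimately show ?thesis
      by (simp add: G_def x_def mult_ac)
  qed simp
  then have eq: "l ^ Suc N * G = l ^ Suc (total_deg F) * R"
    by (intro poly_ext)
  have "s ^ low_deg f dvd R"
    unfolding R_def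
  proof (intro dvd_sum dvd_smult dvd_mult2 le_imp_power_dvd)
    fix m assume "m \<in> Poly_Mapping.keys f"
    then show "low_deg f \<le> monom_deg m"
      unfolding low_deg_def by (intro Min_le) auto
  qed
  then have dvd: "s ^ low_deg f dvd l ^ Suc N * G"
    unfolding eq by (rule dvd_mult)
  have "s ^ low_deg f dvd G"
  proof (cases "G = 0")
    case False
    then have nz: "l ^ Suc N * G \<noteq> 0" using l0 by auto
    have "low_deg f \<le> order t\<^sub>0 (l ^ Suc N * G)"
      using dvd nz by (simp add: s_def order_divides del: power_Suc)
    also have "\<dots> = order t\<^sub>0 G"
      using l0 by (simp add: order_mult[OF nz] order_0I del: power_Suc)
    finally show ?thesis by (simp add: s_def order_divides)
  qed simp
  then show ?thesis
    by (simp add: s_def G_def f_def v_def curve_mult_def)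
qed

text \<open>This is the part of Bezout's theorem that the proof needs. The restriction of the form to
  the line through \<open>b\<close> and \<open>c\<close> is a polynomial in one variable whose degree is at most the degree
  of the form, and its roots, counted with their orders, dominate the multiplicities. Letting
  \<open>c\<close> be the point at infinity of the parametrization ensures that the restriction is not zero
  and that no zero of the form on that line is missed.\<close>

lemma sum_curve_mult_le_total_deg:
  assumes F: "homogeneous3 F" and c: "eval3 F c \<noteq> 0"
    and T: "finite T" "\<And>t. t \<in> T \<Longrightarrow> b + t *s c \<noteq> 0"
  shows "(\<Sum>t\<in>T. curve_mult (point (b + t *s c)) F) \<le> total_deg F"
proof -
  define G where "G = line_poly F b c"
  have G: "G \<noteq> 0"
  proof
    assume G0: "G = 0"
    have F0: "eval3 F (b + t *s c) = 0" for t
      using G0 poly_line_poly[of F b c t] by (simp add: G_def)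
    \<comment> \<open>By homogeneity \<open>F\<close> vanishes on \<open>c + t b\<close> for \<open>t \<noteq> 0\<close>; the factor \<open>t\<close> handles \<open>t = 0\<close>.\<close>
    have "poly ([:0, 1:] * line_poly F c b) t = 0" for t
    proof (cases "t = 0")
      case False
      then have "c + t *s b = t *s (b + inverse t *s c)"
        by (simp add: vec_eq_iff algebra_simps)
      then have "eval3 F (c + t *s b) = t ^ total_deg F * eval3 F (b + inverse t *s c)"
        using eval3_scale[OF F] by metis
      then show ?thesis
        unfolding poly_mult poly_line_poly by (simp add: F0)
    qed simp
    then have "[:0, 1:] * line_poly F c b = 0"
      using poly_all_0_iff_0 by blast
    then have "poly (line_poly F c b) 0 = 0" by simp
    with c show False by simp
  qed
  have "(\<Sum>t\<in>T. curve_mult (point (b + t *s c)) F) \<le> (\<Sum>t\<in>T. order t G)"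
    using curve_mult_dvd_line_poly[OF F T(2)] G
    by (intro sum_mono) (auto simp: order_divides G_def)
  also have "\<dots> = (\<Sum>t\<in>T \<inter> {t. poly G t = 0}. order t G)"
    using T(1) by (intro sum.mono_neutral_right) (auto simp: order_0I)
  also have "\<dots> \<le> (\<Sum>t | poly G t = 0. order t G)"
    using poly_roots_finite[OF G] by (intro sum_mono2) auto
  also have "\<dots> \<le> degree G" by (rule sum_order_le_degree[OF G])
  also have "\<dots> \<le> total_deg F" unfolding G_def by (rule degree_line_poly)
  finally show ?thesis .
qed

text \<open>The bound along a line through the given point and a point off the curve.\<close>

lemma curve_mult_le_total_deg:
  assumes "homogeneous3 F" "F \<noteq> 0"
  shows "curve_mult p F \<le> total_deg F"
proof -
  obtain v where v: "v \<noteq> 0" "p = point v" by (rule point_exhaust)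
  obtain c where "eval3 F c \<noteq> 0"
    using poly3_eqI[of F 0] assms(2) by auto
  from sum_curve_mult_le_total_deg[OF assms(1) this, of "{0}" v] v show ?thesis by simp
qed

section \<open>Lines in the projective plane\<close>

text \<open>The bilinear product, without complex conjugation: \<open>dot a\<close> is the linear form with
  coefficient vector \<open>a\<close>.\<close>

definition dot :: "complex^3 \<Rightarrow> complex^3 \<Rightarrow> complex" where
  "dot a v = (\<Sum>i\<in>UNIV. a $ i * v $ i)"

lemma dot_add [simp]: "dot a (v + w) = dot a v + dot a w"
  by (simp add: dot_def algebra_simps sum.distrib)

lemma dot_scale [simp]: "dot a (t *s v) = t * dot a v"
  by (simp add: dot_def sum_distrib_left algebra_simps)

lemma dot_diff [simp]: "dot a (v - w) = dot a v - dot a w"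
  using dot_add[of a "v - w" w] by simp

lemma dot_zero [simp]: "dot a 0 = 0"
  by (simp add: dot_def)

lemma dot_axis [simp]: "dot a (axis i 1) = a $ i"
proof -
  have "dot a (axis i 1) = (\<Sum>j\<in>UNIV. if j = i then a $ i else 0)"
    unfolding dot_def by (intro sum.cong) (auto simp: axis_def)
  then show ?thesis by simp
qed

lemma dot_nonzero:
  assumes "a \<noteq> 0"
  obtains v where "dot a v \<noteq> 0"
  using vec_nonzero_component[OF assms] dot_axis by metis

definition line :: "complex^3 \<Rightarrow> proj_plane set" where
  "line a = {point v | v. v \<noteq> 0 \<and> dot a v = 0}"

lemma is_line_iff: "is_line L \<longleftrightarrow> (\<exists>a. a \<noteq> 0 \<and> L = line a)"
  by (simp add: is_line_def line_def dot_def)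

lemma point_in_line_iff:
  assumes "v \<noteq> 0"
  shows "point v \<in> line a \<longleftrightarrow> dot a v = 0"
proof
  assume "point v \<in> line a"
  then obtain w where w: "w \<noteq> 0" "dot a w = 0" "point w = point v"
    unfolding line_def by auto
  then obtain c where "v = c *s w"
    using point_eq_iff[OF w(1) assms] by auto
  with w show "dot a v = 0" by simp
qed (use assms in \<open>auto simp: line_def\<close>)

definition crossp :: "complex^3 \<Rightarrow> complex^3 \<Rightarrow> complex^3" where
  "crossp a b = vector [a$2 * b$3 - a$3 * b$2, a$3 * b$1 - a$1 * b$3, a$1 * b$2 - a$2 * b$1]"

lemma crossp_component [simp]:
  "crossp a b $ 1 = a$2 * b$3 - a$3 * b$2"
  "crossp a b $ 2 = a$3 * b$1 - a$1 * b$3"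
  "crossp a b $ 3 = a$1 * b$2 - a$2 * b$1"
  by (simp_all add: crossp_def)

lemma dot_crossp [simp]: "dot a (crossp a b) = 0" "dot b (crossp a b) = 0"
  by (simp_all add: dot_def sum_3 algebra_simps)

text \<open>The cross product detects proportionality, so it produces both the intersection point of
  two lines and the line through two points.\<close>

lemma crossp_eq_0D:
  assumes "crossp x y = 0" "x \<noteq> 0"
  obtains k where "y = k *s x"
proof -
  obtain i where i: "x $ i \<noteq> 0" by (rule vec_nonzero_component[OF assms(2)])
  have *: "x$2 * y$3 = x$3 * y$2" "x$3 * y$1 = x$1 * y$3" "x$1 * y$2 = x$2 * y$1"
    using assms(1) by (simp_all add: vec_eq_iff forall_3)
  have "\<forall>i j. x $ i * y $ j = x $ j * y $ i"
    unfolding forall_3 using * by simp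
  then have "y = (y $ i / x $ i) *s x"
    using i by (simp add: vec_eq_iff field_simps)
  then show ?thesis by (rule that)
qed

lemma crossp_crossp_eq_0:
  assumes "dot a v = 0" "dot b v = 0"
  shows "crossp v (crossp a b) = 0"
proof -
  have "crossp v (crossp a b) $ i = dot b v * a $ i - dot a v * b $ i" for i
    using exhaust_3[of i] by (auto simp: dot_def sum_3 algebra_simps)
  then show ?thesis by (simp add: vec_eq_iff assms)
qed

lemma dot_commute: "dot a b = dot b a"
  by (simp add: dot_def mult.commute)

lemma lines_meet_in_one_point:
  assumes "a \<noteq> 0" "b \<noteq> 0" "line a \<noteq> line b"
  obtains p where "line a \<inter> line b = {p}"
proof -
  have nz: "crossp a b \<noteq> 0"
  proof
    assume "crossp a b = 0"
    then obtain k where k: "b = k *s a" using crossp_eq_0D assms(1) by blast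
    then have "k \<noteq> 0" using assms(2) by auto
    then have "dot b v = 0 \<longleftrightarrow> dot a v = 0" for v
      unfolding k by (metis dot_commute dot_scale mult_eq_0_iff)
    then show False using assms(3) by (simp add: line_def)
  qed
  have "p = point (crossp a b)" if p: "p \<in> line a" "p \<in> line b" for p
  proof -
    obtain v where v: "v \<noteq> 0" "p = point v" by (rule point_exhaust)
    then have "crossp v (crossp a b) = 0"
      using p by (simp add: crossp_crossp_eq_0 point_in_line_iff)
    then obtain k where k: "crossp a b = k *s v"
      using crossp_eq_0D v(1) by blast
    then have "k \<noteq> 0" using nz by auto
    with k show ?thesis unfolding v(2) point_eq_iff[OF v(1) nz] by blast
  qed
  moreover have "point (crossp a b) \<in> line a \<inter> line b"
    using nz by (simp add: point_in_line_iff)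
  ultimately show ?thesis using that by blast
qed

text \<open>All cross products of two vectors in the plane orthogonal to \<open>a\<close> are multiples of \<open>a\<close>, so
  the determinant of \<open>b\<close>, \<open>c\<close>, \<open>v\<close> vanishes, and Cramer's rule expresses \<open>v\<close> through \<open>b\<close> and \<open>c\<close>.\<close>

lemma plane_spanned:
  assumes a: "a \<noteq> 0" and d: "dot a b = 0" "dot a c = 0" "dot a v = 0" and bc: "crossp b c \<noteq> 0"
  obtains \<beta> \<gamma> where "v = \<beta> *s b + \<gamma> *s c"
proof -
  have "crossp a (crossp b c) = 0"
    using d by (simp add: crossp_crossp_eq_0 dot_commute)
  then obtain m where "crossp b c = m *s a"
    using crossp_eq_0D a by blast
  then have det: "dot (crossp b c) v = 0"
    using d(3) by (metis dot_commute dot_scale mult_zero_right)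
  obtain k where k: "crossp b c $ k \<noteq> 0" by (rule vec_nonzero_component[OF bc])
  \<comment> \<open>This is the expansion of \<open>det (b, c, e) v\<close> for the \<open>k\<close>-th unit vector \<open>e\<close>.\<close>
  have "crossp b c $ k * v $ i - crossp v c $ k * b $ i - crossp b v $ k * c $ i
      = (if i = k then dot (crossp b c) v else 0)" for i
    using exhaust_3[of k] exhaust_3[of i]
    by (elim disjE) (simp_all add: dot_def sum_3 algebra_simps)
  then have "crossp b c $ k * v $ i = crossp v c $ k * b $ i + crossp b v $ k * c $ i" for i
    unfolding det by (simp add: diff_diff_eq)
  then have "v = (crossp v c $ k / crossp b c $ k) *s b + (crossp b v $ k / crossp b c $ k) *s c"
    using k by (simp add: vec_eq_iff field_simps)
  then show ?thesis by (rule that)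
qed

text \<open>The Bezout bound for points of a line that is not contained in the curve. Only points on
  the curve contribute. Choosing \<open>c\<close> on the line but off the curve, and \<open>b\<close> among the
  contributing points, puts each of them at a finite parameter \<open>t\<close> of \<open>b + t c\<close>.\<close>

lemma sum_curve_mult_on_line_le:
  assumes F: "homogeneous3 F" and a: "a \<noteq> 0" and c: "dot a c = 0" "eval3 F c \<noteq> 0"
    and P: "finite P" "P \<subseteq> line a"
  shows "(\<Sum>p\<in>P. curve_mult p F) \<le> total_deg F"
proof -
  define P' where "P' = {p \<in> P. curve_mult p F \<noteq> 0}"
  have sum_P': "(\<Sum>p\<in>P. curve_mult p F) = (\<Sum>p\<in>P'. curve_mult p F)"
    unfolding P'_def using P(1) by (intro sum.mono_neutral_right) auto
  have F0: "F \<noteq> 0" using c(2) by auto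
  have P'_D: "dot a v = 0 \<and> eval3 F v = 0" if "point v \<in> P'" "v \<noteq> 0" for v
    using that(1) P(2) curve_mult_eq_0_iff[OF F F0 that(2)] point_in_line_iff[OF that(2), of a]
    by (auto simp: P'_def)
  show ?thesis
  proof (cases "P' = {}")
    case False
    then obtain b where b: "b \<noteq> 0" "point b \<in> P'"
      using point_exhaust by (metis all_not_in_conv)
    have bc: "crossp b c \<noteq> 0"
    proof
      assume "crossp b c = 0"
      then obtain k where "c = k *s b" using crossp_eq_0D b(1) by blast
      then show False using c(2) P'_D[OF b(2,1)] eval3_scale[OF F] by simp
    qed
    have "\<exists>t. b + t *s c \<noteq> 0 \<and> p = point (b + t *s c)" if "p \<in> P'" for p
    proof -
      obtain v where v: "v \<noteq> 0" "p = point v" by (rule point_exhaust)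
      have Fv: "dot a v = 0" "eval3 F v = 0" using P'_D v that by auto
      obtain \<beta> \<gamma> where eq: "v = \<beta> *s b + \<gamma> *s c"
        using plane_spanned[OF a _ c(1) Fv(1) bc] P'_D[OF b(2,1)] by blast
      have \<beta>: "\<beta> \<noteq> 0"
      proof
        assume "\<beta> = 0"
        then have "v = \<gamma> *s c" using eq by simp
        then have "\<gamma> \<noteq> 0" "eval3 F v = \<gamma> ^ total_deg F * eval3 F c"
          using v(1) eval3_scale[OF F] by auto
        then show False using Fv c(2) by simp
      qed
      have v': "v = \<beta> *s (b + (\<gamma> / \<beta>) *s c)"
        using \<beta> by (simp add: eq vec_eq_iff field_simps)
      then have nz: "b + (\<gamma> / \<beta>) *s c \<noteq> 0"
        using v(1) vector_smult_rzero by metis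
      have "point (b + (\<gamma> / \<beta>) *s c) = point v"
        unfolding point_eq_iff[OF nz v(1)] using v' \<beta> by blast
      then show ?thesis using nz v(2) by metis
    qed
    then obtain \<tau> where \<tau>: "\<And>p. p \<in> P' \<Longrightarrow> b + \<tau> p *s c \<noteq> 0 \<and> p = point (b + \<tau> p *s c)"
      by metis
    have "inj_on \<tau> P'" using \<tau> by (metis inj_onI)
    then have "(\<Sum>p\<in>P'. curve_mult p F) = (\<Sum>t\<in>\<tau> ` P'. curve_mult (point (b + t *s c)) F)"
      using \<tau> by (simp add: sum.reindex)
    also have "\<dots> \<le> total_deg F"
      using \<tau> P(1) by (intro sum_curve_mult_le_total_deg[OF F c(2)]) (auto simp: P'_def)
    finally show ?thesis using sum_P' by simp
  qed (use sum_P' in simp)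
qed

section \<open>Linear forms and the lines they define\<close>

definition linear_form :: "complex^3 \<Rightarrow> poly3" where
  "linear_form a = (\<Sum>i\<in>UNIV. const3 (a $ i) * var3 i)"

lemma eval3_linear_form [simp]: "eval3 (linear_form a) v = dot a v"
  by (simp add: linear_form_def dot_def)

lemma homogeneous3_linear_form: "homogeneous3 (linear_form a)"
proof -
  have "const3 (a $ i) * var3 i = Poly_Mapping.single (Poly_Mapping.single i 1) (a $ i)" for i
    by (simp add: const3_def var3_def mult_single)
  then have "Poly_Mapping.keys (linear_form a) \<subseteq> (\<Union>i. {Poly_Mapping.single i 1})"
    unfolding linear_form_def by (intro order_trans[OF keys_sum] UN_mono) auto
  moreover have "monom_deg (Poly_Mapping.single i 1) = 1" for i
    by (simp add: monom_deg_def lookup_single when_def)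
  ultimately show ?thesis unfolding homogeneous3_def by blast
qed

text \<open>A form that evaluates to a nonzero multiple of a linear form has degree one, as its scaling
  behaviour shows; with the bound of multiplicities by the degree, its multiplicities follow.\<close>

lemma total_deg_linear:
  assumes F: "homogeneous3 F" and eq: "\<And>v. eval3 F v = k * dot a v" and nz: "k \<noteq> 0" "a \<noteq> 0"
  shows "total_deg F = 1"
proof -
  obtain v where "dot a v \<noteq> 0" using dot_nonzero[OF nz(2)] by blast
  then have "(2::complex) ^ total_deg F = 2 ^ 1"
    using eval3_scale[OF F, of 2 v] nz(1) by (simp add: eq)
  then have "norm ((2::complex) ^ total_deg F) = norm ((2::complex) ^ 1)"
    by (rule arg_cong)
  then have "(2::real) ^ total_deg F = 2 ^ 1"
    by (simp add: norm_power)
  then show ?thesis by (subst (asm) power_inject_exp) auto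
qed

lemma curve_mult_linear:
  assumes F: "homogeneous3 F" and eq: "\<And>v. eval3 F v = k * dot a v" and nz: "k \<noteq> 0" "a \<noteq> 0"
  shows "curve_mult p F = (if p \<in> line a then 1 else 0)"
proof -
  obtain v where v: "v \<noteq> 0" "p = point v" by (rule point_exhaust)
  have F0: "F \<noteq> 0"
    using dot_nonzero[OF nz(2)] nz(1) eq by (metis eval3_zero mult_eq_0_iff)
  have "curve_mult p F \<le> 1"
    using curve_mult_le_total_deg[OF F F0] total_deg_linear[OF assms] by simp
  moreover have "curve_mult p F = 0 \<longleftrightarrow> p \<notin> line a"
    unfolding v(2) curve_mult_eq_0_iff[OF F F0 v(1)] point_in_line_iff[OF v(1)] eq using nz by simp
  ultimately show ?thesis by auto
qed

lemma const3_dvd_1: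
  assumes "k \<noteq> 0"
  shows "const3 k dvd 1"
proof
  show "1 = const3 k * const3 (inverse k)"
    using assms by (simp add: const3_def mult_single)
qed

text \<open>On every line through the origin, a unit and its inverse become polynomials in one variable
  with product one, hence constants.\<close>

lemma unit_imp_const3:
  assumes "Q dvd 1"
  obtains k where "k \<noteq> 0" "Q = const3 k"
proof -
  obtain R where R: "1 = Q * R" using assms by (rule dvdE)
  have "eval3 Q v = eval3 Q 0" for v
  proof -
    define q where "q = line_poly Q 0 v"
    define r where "r = line_poly R 0 v"
    have "poly (q * r) t = poly 1 t" for t
      using arg_cong[OF R, of "\<lambda>F. eval3 F (0 + t *s v)"] by (simp add: q_def r_def)
    then have "q * r = 1" by (intro poly_ext)
    then have "degree q = 0"
      using degree_mult_eq[of q r] by (cases "q = 0"; cases "r = 0") auto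
    then obtain k where "q = [:k:]" by (rule degree_eq_zeroE)
    then have "poly q 1 = poly q 0" by simp
    then show ?thesis by (simp add: q_def)
  qed
  then have "Q = const3 (eval3 Q 0)" by (intro poly3_eqI) simp
  moreover have "eval3 Q 0 \<noteq> 0"
    using arg_cong[OF R, of "\<lambda>F. eval3 F 0"] by auto
  ultimately show ?thesis using that by blast
qed

text \<open>On a line through the origin that is not contained in \<open>dot a v = 0\<close>, the product \<open>G * H\<close> has
  degree one, and \<open>G\<close> takes all of it since \<open>G\<close> vanishes at the origin. So \<open>H\<close> is constant off the
  plane \<open>dot a v = 0\<close>, and then everywhere.\<close>

lemma linear_form_factor_unit:
  assumes a: "a \<noteq> 0" and GH: "linear_form a = G * H" and G0: "eval3 G 0 = 0"
  shows "H dvd 1"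
proof -
  have off: "eval3 H v = eval3 H 0 \<and> eval3 H 0 \<noteq> 0" if v: "dot a v \<noteq> 0" for v
  proof -
    define g where "g = line_poly G 0 v"
    define h where "h = line_poly H 0 v"
    have "poly (g * h) t = poly [:0, dot a v:] t" for t
      using arg_cong[OF GH, of "\<lambda>F. eval3 F (0 + t *s v)"] by (simp add: g_def h_def)
    then have gh: "g * h = [:0, dot a v:]" by (intro poly_ext)
    then have nz: "g \<noteq> 0" "h \<noteq> 0" using v by auto
    have "degree g + degree h = 1"
      using degree_mult_eq[OF nz] v unfolding gh by simp
    moreover have "degree g \<noteq> 0"
    proof
      assume "degree g = 0"
      then obtain k where "g = [:k:]" by (rule degree_eq_zeroE)
      moreover have "poly g 0 = 0" using G0 by (simp add: g_def)
      ultimately show False using nz by simp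
    qed
    ultimately have "degree h = 0" by simp
    then obtain k where k: "h = [:k:]" by (rule degree_eq_zeroE)
    then have "poly h 1 = k" "poly h 0 = k" by simp_all
    then show ?thesis using nz k by (simp add: h_def)
  qed
  obtain u where u: "dot a u \<noteq> 0" using dot_nonzero[OF a] by blast
  have "eval3 H v = eval3 H 0" for v
  proof (cases "dot a v = 0")
    case True
    define q where "q = line_poly H v u - [:eval3 H 0:]"
    have "poly ([:0, 1:] * q) t = 0" for t
      using off[of "v + t *s u"] True u unfolding poly_mult q_def by auto
    then have "[:0, 1:] * q = 0" using poly_all_0_iff_0 by blast
    then have "poly q 0 = 0" by simp
    then show ?thesis by (simp add: q_def)
  qed (use off in blast)
  then have "H = const3 (eval3 H 0)" by (intro poly3_eqI) simp
  then show ?thesis using const3_dvd_1 off[OF u] by metis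
qed

lemma linear_form_not_unit: "\<not> linear_form a dvd 1"
proof
  assume "linear_form a dvd 1"
  then obtain k where k: "k \<noteq> 0" "linear_form a = const3 k" by (rule unit_imp_const3)
  from arg_cong[OF k(2), of "\<lambda>F. eval3 F 0"] k(1) show False by simp
qed

text \<open>In any factorization of a linear form, one of the factors vanishes at the origin; the other
  one is then a unit.\<close>

lemma irreducible_linear_form:
  assumes "a \<noteq> 0"
  shows "irreducible (linear_form a)"
proof (rule irreducibleI)
  show "linear_form a \<noteq> 0"
    using dot_nonzero[OF assms] eval3_linear_form by (metis eval3_zero)
  show "\<not> linear_form a dvd 1" by (rule linear_form_not_unit)
next
  fix G H assume GH: "linear_form a = G * H"
  have "eval3 G 0 * eval3 H 0 = 0"
    using arg_cong[OF GH, of "\<lambda>F. eval3 F 0"] by simp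
  then show "G dvd 1 \<or> H dvd 1"
    using linear_form_factor_unit[OF assms GH] linear_form_factor_unit[OF assms, of H G] GH
    by (auto simp: mult.commute)
qed

lemma dvd_diff_prod:
  fixes l :: "'a :: comm_ring_1"
  assumes "\<And>x. l dvd f x - g x"
  shows "l dvd prod f S - prod g S"
proof (induction S rule: infinite_finite_induct)
  case (insert x S)
  have "prod f (insert x S) - prod g (insert x S) =
      (f x - g x) * prod f S + g x * (prod f S - prod g S)"
    using insert.hyps by (simp add: algebra_simps)
  then show ?case using assms[of x] insert.IH by (metis dvd_add dvd_mult dvd_mult2)
qed auto

lemma dvd_diff_power:
  fixes l :: "'a :: comm_ring_1"
  assumes "l dvd x - y"
  shows "l dvd x ^ n - y ^ n"
  using dvd_diff_prod[of l "\<lambda>_. x" "\<lambda>_. y" "{..<n}"] assms by simp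

text \<open>The Nullstellensatz for a single linear form. Solving \<open>dot a v = 0\<close> for a coordinate with
  nonzero coefficient and substituting the solution leaves \<open>F\<close> unchanged modulo the linear form,
  and it turns \<open>F\<close> into a polynomial all of whose values are values of \<open>F\<close> on that plane.\<close>

lemma linear_form_dvd:
  assumes a: "a \<noteq> 0" and F: "\<And>v. dot a v = 0 \<Longrightarrow> eval3 F v = 0"
  shows "linear_form a dvd F"
proof -
  obtain i where i: "a $ i \<noteq> 0" by (rule vec_nonzero_component[OF a])
  define g where "g j = (if j = i then var3 i - const3 (inverse (a $ i)) * linear_form a else var3 j)" for j
  have "subst3 F g = 0"
  proof (rule poly3_eqI)
    fix v
    define w where "w = v - (inverse (a $ i) * dot a v) *s axis i 1"
    have "(\<chi> j. eval3 (g j) v) = w"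
      by (auto simp: g_def w_def vec_eq_iff axis_def)
    moreover have "dot a w = 0" using i by (simp add: w_def)
    ultimately show "eval3 (subst3 F g) v = eval3 0 v"
      using F by (simp add: eval3_subst3)
  qed
  moreover have "subst3 F var3 = F"
    by (rule poly3_eqI) (simp add: eval3_subst3)
  moreover have "linear_form a dvd subst3 F var3 - subst3 F g"
    unfolding subst3_def sum_subtractf[symmetric] right_diff_distrib[symmetric]
  proof (rule dvd_sum, rule dvd_mult, rule dvd_diff_prod, rule dvd_diff_power)
    fix j show "linear_form a dvd var3 j - g j" by (simp add: g_def)
  qed
  ultimately show ?thesis by simp
qed

lemma integral_curve_containing_line:
  assumes F: "integral_curve F" and a: "a \<noteq> 0" and v: "\<And>v. dot a v = 0 \<Longrightarrow> eval3 F v = 0"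
  obtains k where "k \<noteq> 0" "\<And>v. eval3 F v = k * dot a v"
proof -
  obtain Q where Q: "F = linear_form a * Q"
    using linear_form_dvd[OF a v] by (rule dvdE)
  then have "Q dvd 1"
    using F linear_form_not_unit irreducibleD unfolding integral_curve_def by blast
  then obtain k where k: "k \<noteq> 0" "Q = const3 k" by (rule unit_imp_const3)
  show ?thesis
    by (rule that[of k]) (use k Q in \<open>simp_all add: mult.commute\<close>)
qed

section \<open>Star arrangements\<close>

lemma star_arrangement_lines_meet:
  assumes "star_arrangement A" "L \<in> A" "M \<in> A" "L \<noteq> M"
  obtains p where "L \<inter> M = {p}"
proof -
  have "is_line L" "is_line M"
    using assms(1-3) by (simp_all add: star_arrangement_def line_arrangement_def)
  then obtain a b where ab: "a \<noteq> 0" "L = line a" "b \<noteq> 0" "M = line b"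
    unfolding is_line_iff by blast
  then obtain p where "L \<inter> M = {p}"
    using lines_meet_in_one_point[of a b] assms(4) by metis
  then show ?thesis by (rule that)
qed

lemma star_lines_through:
  assumes A: "star_arrangement A" and LM: "L \<in> A" "M \<in> A" "L \<noteq> M" and p: "p \<in> L" "p \<in> M"
  shows "p \<in> Sing A" "{K \<in> A. p \<in> K} = {L, M}"
proof -
  have fin: "finite {K \<in> A. p \<in> K}"
    using A by (simp add: star_arrangement_def line_arrangement_def)
  have sub: "{L, M} \<subseteq> {K \<in> A. p \<in> K}" using LM p by auto
  have "card {L, M} = 2" using LM by simp
  with card_mono[OF fin sub] show "p \<in> Sing A" by (simp add: Sing_def)
  then have "card {K \<in> A. p \<in> K} = 2" using A by (simp add: star_arrangement_def)
  with card_subset_eq[OF fin sub] \<open>card {L, M} = 2\<close> show "{K \<in> A. p \<in> K} = {L, M}" by simp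
qed

lemma Sing_other_line:
  assumes "p \<in> Sing A" 
  obtains M where "M \<in> A" "M \<noteq> L" "p \<in> M"
proof (rule ccontr)
  assume "\<not> thesis"
  then have "{K \<in> A. p \<in> K} \<subseteq> {L}" using that by blast
  then have "card {K \<in> A. p \<in> K} \<le> card {L}" by (intro card_mono) auto
  with assms show False by (simp add: Sing_def)
qed

text \<open>The other lines of the arrangement meet \<open>L\<close> in one point each, and these points are pairwise
  distinct since all intersection points are double. They are the singular points on \<open>L\<close>.\<close>

lemma card_Sing_on_line:
  assumes A: "star_arrangement A" and L: "L \<in> A"
  shows "finite (Sing A \<inter> L)" "card (Sing A \<inter> L) = card A - 1"
proof -
  have fin: "finite A" using A by (simp add: star_arrangement_def line_arrangement_def)
  define q where "q M = (SOME p. L \<inter> M = {p})" for M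
  have q: "L \<inter> M = {q M}" if "M \<in> A - {L}" for M
    unfolding q_def using star_arrangement_lines_meet[OF A L, of M] that by (metis (mono_tags, lifting) DiffE insertI1 someI_ex)
  have "bij_betw q (A - {L}) (Sing A \<inter> L)"
  proof (rule bij_betw_imageI)
    show "inj_on q (A - {L})"
    proof (rule inj_onI)
      fix M N assume MN: "M \<in> A - {L}" "N \<in> A - {L}" "q M = q N"
      then have "q M \<in> L" "q M \<in> M" "q M \<in> N" using q by blast+
      then have "N \<in> {L, M}"
        using star_lines_through(2)[OF A L, of M "q M"] MN by blast
      then show "M = N" using MN by blast
    qed
    show "q ` (A - {L}) = Sing A \<inter> L"
    proof (intro equalityI subsetI)
      fix p assume "p \<in> q ` (A - {L})"
      then obtain M where M: "M \<in> A" "M \<noteq> L" "p = q M" by blast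
      then have "p \<in> L" "p \<in> M" using q by blast+
      then show "p \<in> Sing A \<inter> L" using star_lines_through(1)[OF A L M(1)] M by blast
    next
      fix p assume p: "p \<in> Sing A \<inter> L"
      then obtain M where "M \<in> A" "M \<noteq> L" "p \<in> M" using Sing_other_line by blast
      then show "p \<in> q ` (A - {L})" using q p by blast
    qed
  qed
  then show "finite (Sing A \<inter> L)" "card (Sing A \<inter> L) = card A - 1"
    using fin L bij_betw_finite bij_betw_same_card by fastforce+
qed

lemma finite_Sing:
  assumes "star_arrangement A"
  shows "finite (Sing A)"
proof -
  have "Sing A \<subseteq> (\<Union>L\<in>A. Sing A \<inter> L)"
  proof
    fix p assume p: "p \<in> Sing A"
    then obtain M where "M \<in> A" "p \<in> M" by (rule Sing_other_line)
    with p show "p \<in> (\<Union>L\<in>A. Sing A \<inter> L)" by blast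
  qed
  moreover have "finite (\<Union>L\<in>A. Sing A \<inter> L)"
    using assms card_Sing_on_line(1)
    by (intro finite_UN_I) (auto simp: star_arrangement_def line_arrangement_def)
  ultimately show ?thesis by (rule finite_subset)
qed

lemma sum_curve_mult_arrangement_line:
  assumes A: "star_arrangement A" and L: "line a \<in> A" and a: "a \<noteq> 0" "k \<noteq> 0"
    and F: "homogeneous3 F" "\<And>v. eval3 F v = k * dot a v"
  shows "(\<Sum>p\<in>Sing A. curve_mult p F) = card A - 1"
proof -
  have "(\<Sum>p\<in>Sing A. curve_mult p F) = (\<Sum>p\<in>Sing A. if p \<in> line a then 1 else 0)"
    using curve_mult_linear[OF F a(2,1)] by simp
  also have "\<dots> = card (Sing A \<inter> line a)"
    using finite_Sing[OF A] by (simp add: sum.If_cases)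
  finally show ?thesis using card_Sing_on_line(2)[OF A L] by simp
qed

text \<open>If the curve is a line of the arrangement, equality holds. Otherwise the Bezout bound applies
  to each of the lines, and summing these bounds counts every singular point exactly twice.
  This gives half of \<open>card A\<close> times the degree, which is at most the stated bound.\<close>

lemma sum_curve_mult_Sing_le:
  assumes A: "star_arrangement A" "card A \<ge> 2" and F: "integral_curve F"
  shows "(\<Sum>p\<in>Sing A. curve_mult p F) \<le> (card A - 1) * total_deg F"
proof (cases "\<exists>a. a \<noteq> 0 \<and> line a \<in> A \<and> (\<forall>v. dot a v = 0 \<longrightarrow> eval3 F v = 0)")
  case True
  then obtain a where a: "a \<noteq> 0" "line a \<in> A" "\<And>v. dot a v = 0 \<Longrightarrow> eval3 F v = 0" by blast
  have hom: "homogeneous3 F" using F by (simp add: integral_curve_def)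
  obtain k where k: "k \<noteq> 0" "\<And>v. eval3 F v = k * dot a v"
    using integral_curve_containing_line[OF F a(1,3)] by blast
  show ?thesis
    using sum_curve_mult_arrangement_line[OF A(1) a(2,1) k(1) hom k(2)] total_deg_linear[OF hom k(2) k(1) a(1)] by simp
next
  case False
  have hom: "homogeneous3 F" using F by (simp add: integral_curve_def)
  have fin: "finite A" and lines: "\<And>L. L \<in> A \<Longrightarrow> is_line L"
    using A by (simp_all add: star_arrangement_def line_arrangement_def)
  have "2 * (\<Sum>p\<in>Sing A. curve_mult p F) = (\<Sum>p\<in>Sing A. \<Sum>L | L \<in> A \<and> p \<in> L. curve_mult p F)"
    using A(1) by (simp add: sum_distrib_left star_arrangement_def)
  also have "\<dots> = (\<Sum>L\<in>A. \<Sum>p | p \<in> Sing A \<and> p \<in> L. curve_mult p F)"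
    using finite_Sing[OF A(1)] fin by (rule sum.swap_restrict)
  also have "\<dots> \<le> (\<Sum>L\<in>A. total_deg F)"
  proof (rule sum_mono)
    fix L assume L: "L \<in> A"
    then obtain a where a: "a \<noteq> 0" "L = line a" using lines is_line_iff by blast
    then obtain c where c: "dot a c = 0" "eval3 F c \<noteq> 0" using False L by blast
    show "(\<Sum>p | p \<in> Sing A \<and> p \<in> L. curve_mult p F) \<le> total_deg F"
      using finite_Sing[OF A(1)] a by (intro sum_curve_mult_on_line_le[OF hom a(1) c]) auto
  qed
  also have "\<dots> = card A * total_deg F" by simp
  also have "\<dots> \<le> 2 * ((card A - 1) * total_deg F)"
  proof -
    have "card A \<le> 2 * (card A - 1)" using A(2) by simp
    then show ?thesis by (metis mult.assoc mult_le_mono1)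
  qed
  finally show ?thesis by simp
qed

theorem proposition3p7:
  fixes A :: "proj_plane set set" and d :: nat
  assumes "star_arrangement A" and "card A = d" and "d \<ge> 3"
  shows "seshadri_O1 (Sing A) = 1 / (real d - 1)"
proof -
  define C where "C = {F. integral_curve F \<and> curve_points F \<inter> Sing A \<noteq> {}}"
  define r where "r F = real (total_deg F) / (\<Sum>p\<in>Sing A. real (curve_mult p F))" for F
  have "A \<noteq> {}" using assms by auto
  then obtain L where L: "L \<in> A" by blast
  then obtain a where a: "a \<noteq> 0" "L = line a"
    using assms(1) by (auto simp: star_arrangement_def line_arrangement_def is_line_iff)
  have la: "\<And>v. eval3 (linear_form a) v = 1 * dot a v" by simp
  have attained: "r (linear_form a) = 1 / (real d - 1)"
  proof -
    have "(\<Sum>p\<in>Sing A. real (curve_mult p (linear_form a))) = real (\<Sum>p\<in>Sing A. curve_mult p (linear_form a))"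
      by simp
    also have "\<dots> = real d - 1"
      using sum_curve_mult_arrangement_line[OF assms(1) _ a(1) one_neq_zero homogeneous3_linear_form la] L a assms by simp
    finally show ?thesis
      unfolding r_def using total_deg_linear[OF homogeneous3_linear_form la one_neq_zero a(1)] by simp
  qed
  have in_C: "linear_form a \<in> C"
  proof -
    have "card (Sing A \<inter> L) \<noteq> 0"
      using card_Sing_on_line(2)[OF assms(1) L] assms by simp
    then have "Sing A \<inter> L \<noteq> {}" by auto
    moreover have "curve_points (linear_form a) = L"
      by (simp add: curve_points_def a(2) line_def)
    ultimately show ?thesis
      using irreducible_linear_form[OF a(1)] homogeneous3_linear_form
      by (auto simp: C_def integral_curve_def)
  qed
  have lower: "1 / (real d - 1) \<le> r F" if F: "F \<in> C" for F
  proof -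
    have ic: "integral_curve F" and hom: "homogeneous3 F" and nz: "F \<noteq> 0"
      using F by (auto simp: C_def integral_curve_def irreducible_def)
    obtain v where v: "v \<noteq> 0" "eval3 F v = 0" "point v \<in> Sing A"
      using F by (auto simp: C_def curve_points_def)
    let ?S = "\<Sum>p\<in>Sing A. curve_mult p F"
    have "curve_mult (point v) F \<noteq> 0"
      using curve_mult_eq_0_iff[OF hom nz v(1)] v(2) by simp
    moreover have "curve_mult (point v) F \<le> ?S"
      using v(3) finite_Sing[OF assms(1)] by (intro member_le_sum) auto
    ultimately have pos: "?S > 0" by simp
    have "?S \<le> (d - 1) * total_deg F"
      using sum_curve_mult_Sing_le[OF assms(1) _ ic] assms by simp
    then have "real ?S \<le> real ((d - 1) * total_deg F)"
      by (simp only: of_nat_le_iff)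
    also have "\<dots> = (real d - 1) * real (total_deg F)"
      using assms(3) by (simp add: of_nat_diff)
    finally have le: "real ?S \<le> (real d - 1) * real (total_deg F)" .
    have "0 < real ?S" using pos by (simp only: of_nat_0_less_iff)
    then have "1 / (real d - 1) \<le> real (total_deg F) / real ?S"
      using le assms(3) by (simp only: divide_le_eq le_divide_eq) (simp add: divide_le_eq mult.commute)
    then show ?thesis by (simp add: r_def)
  qed
  have "Inf (r ` C) = 1 / (real d - 1)"
  proof (rule cInf_eq_minimum)
    show "1 / (real d - 1) \<in> r ` C"
      using in_C attained by (metis image_eqI)
  qed (use lower in blast)
  then show ?thesis by (simp add: seshadri_O1_def C_def r_def)
qed

end
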